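(* Let $n,m\geq 1$ be integers, let $A\subset\mathbb{R}^n$ and let $w\in\mathbb{R}^m$ be a unit vector. Let $v\colon\mathbb{R}^n\to\mathbb{R}^m$ and $u\colon A\to\mathbb{R}^m$ be $1$-Lipschitz maps such that $v(x)-u(x)\in\mathbb{R}w$ for all $x\in A$. Then there exists a $1$-Lipschitz extension $\tilde{u}\colon \mathbb{R}^n\to\mathbb{R}^m$ of $u$ such that $v(x)-\tilde{u}(x)\in\mathbb{R}w$ for all $x\in\mathbb{R}^n$ if and only if $$|\langle u(x)-u(y),w\rangle|\leq d_v^w(x,y)\quad\text{for all }x,y\in A. \qquad ( * )$$ Moreover, if $\delta\ge 0$ is such that $\lVert u(x)-v(x)\rVert\leq \delta$ for all $x\in A$ and condition $( * )$ is satisfied, then there exists a $1$-Lipschitz extension $\tilde{u}\colon\mathbb{R}^n\to\mathbb{R}^m$ of $u$ such that $\lVert v(x)-\tilde{u}(x)\rVert\leq \delta$ for all $x\in\mathbb{R}^n$.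
   Context: $1$-Lipschitz is meant with respect to the Euclidean norms. For a $1$-Lipschitz map $v\colon\mathbb{R}^n\to\mathbb{R}^m$ and a unit vector $w\in\mathbb{R}^m$, the pseudo-metric $d_v^w$ on $\mathbb{R}^n$ is $$d_v^w(x,y)=\inf \Big\{\int_a^b \sqrt{\lVert\dot{z}(t)\rVert^2-\lVert D(v\circ z)(t)\rVert^2+\langle w,D(v\circ z)(t)\rangle^2}\,dt \;\Big|\; z\in \mathcal{C}^1([a,b],\mathbb{R}^n),\ z(a)=x,\ z(b)=y \Big\}.$$ Here $D(v\circ z)(t)\in\mathbb{R}^m$ is the derivative at $t$ of the Lipschitz curve $v\circ z\colon[a,b]\to\mathbb{R}^m$, which exists for almost every $t$ by Rademacher's theorem. *)

theory Defs
  imports "HOL-Analysis.Analysis"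
begin

text \<open>
  In the set below, \<open>z'\<close> is the (unique) derivative of the \<open>C\<^sup>1\<close> curve \<open>z\<close>, one-sided at the two
  end points. If \<open>v\<close> is Lipschitz, then \<open>v \<circ> z\<close> is differentiable almost everywhere on \<open>{a..b}\<close>;
  on the exceptional null set \<open>vector_derivative\<close> has an unspecified value, which does not
  affect the integral. If moreover \<open>v\<close> is 1-Lipschitz and \<open>w\<close> is a unit vector, then the radicand
  is nonnegative almost everywhere, so the infimum is over a nonempty set of nonnegative numbers.
\<close>

definition curve_dist ::
  "(real^'n \<Rightarrow> real^'m) \<Rightarrow> real^'m \<Rightarrow> real^'n \<Rightarrow> real^'n \<Rightarrow> real" where
  "curve_dist v w x y =
     Inf {integral {a..b}
            (\<lambda>t. sqrt ((norm (z' t))\<^sup>2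
                       - (norm (vector_derivative (v \<circ> z) (at t within {a..b})))\<^sup>2
                       + (w \<bullet> vector_derivative (v \<circ> z) (at t within {a..b}))\<^sup>2))
          | a b z z'.
            a < b \<and>
            (\<forall>t\<in>{a..b}. (z has_vector_derivative z' t) (at t within {a..b})) \<and>
            continuous_on {a..b} z' \<and>
            z a = x \<and> z b = y}"

end

theory Submission
  imports Defs
begin

text \<open>
  Write \<open>P\<close> for the orthogonal projection onto the complement of \<open>w\<close>. Along a curve \<open>z\<close> the radicand
  in the definition of \<open>curve_dist\<close> is \<open>\<parallel>z'\<parallel>\<^sup>2 - \<parallel>D(P \<circ> v \<circ> z)\<parallel>\<^sup>2\<close>. If \<open>u'\<close> is a 1-Lipschitz extension as
  required, then \<open>P \<circ> u' = P \<circ> v\<close>, so \<open>\<bar>D\<langle>u' \<circ> z, w\<rangle>\<bar>\<close> is at most the integrand, and integration gives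
  the condition. Conversely, McShane's formula \<open>f x = Inf {\<langle>u a, w\<rangle> + curve_dist v w a x | a. a \<in> A}\<close> extends
  \<open>\<langle>u, w\<rangle>\<close> with \<open>f y - f x \<le> curve_dist v w x y\<close>; testing with the segment from \<open>x\<close> to \<open>y\<close> bounds the latter by
  \<open>sqrt (\<parallel>x - y\<parallel>\<^sup>2 - \<parallel>P (v x) - P (v y)\<parallel>\<^sup>2)\<close>, so \<open>P v + f w\<close> is 1-Lipschitz. Since \<open>\<langle>v, w\<rangle>\<close> satisfies the same
  bound, truncating \<open>f\<close> to \<open>[\<langle>v, w\<rangle> - \<delta>, \<langle>v, w\<rangle> + \<delta>]\<close> preserves it and gives the last claim.

  The integrals are meaningful because a Lipschitz curve is almost everywhere differentiable and is the
  integral of its derivative.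
\<close>

subsection \<open>Lipschitz functions of one real variable\<close>

text \<open>Phrased with forward and backward quotients because the differentiation theorem for
  integrals used next speaks of averages over intervals lying to the right of a point.\<close>

lemma has_vector_derivative_of_one_sided_quotients:
  fixes F :: "real \<Rightarrow> 'b::real_normed_vector"
  assumes r: "\<And>e. 0 < e \<Longrightarrow> \<exists>d>0. \<forall>h. 0 < h \<and> h < d \<longrightarrow> norm ((F (x + h) - F x) /\<^sub>R h - D) < e"
    and l: "\<And>e. 0 < e \<Longrightarrow> \<exists>d>0. \<forall>h. 0 < h \<and> h < d \<longrightarrow> norm ((F x - F (x - h)) /\<^sub>R h - D) < e"
  shows "(F has_vector_derivative D) (at x)"
  unfolding has_vector_derivative_def has_derivative_at_alt
proof (intro conjI allI impI)
  fix e :: real assume "0 < e"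
  from r[OF this] obtain d1 where d1: "0 < d1"
      "\<And>h. 0 < h \<Longrightarrow> h < d1 \<Longrightarrow> norm ((F (x + h) - F x) /\<^sub>R h - D) < e" by blast
  from l[OF \<open>0 < e\<close>] obtain d2 where d2: "0 < d2"
      "\<And>h. 0 < h \<Longrightarrow> h < d2 \<Longrightarrow> norm ((F x - F (x - h)) /\<^sub>R h - D) < e" by blast
  have scale: "norm (A - h *\<^sub>R D) \<le> e * h" if "0 < h" "norm (A /\<^sub>R h - D) < e" for A h
  proof -
    have "A - h *\<^sub>R D = h *\<^sub>R (A /\<^sub>R h - D)"
      using that by (simp add: algebra_simps)
    then have "norm (A - h *\<^sub>R D) = h * norm (A /\<^sub>R h - D)"
      using that by (metis abs_of_pos norm_scaleR)
    then show ?thesis using that by (simp add: mult.commute)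
  qed
  have "norm (F y - F x - (y - x) *\<^sub>R D) \<le> e * norm (y - x)" if "norm (y - x) < min d1 d2" for y
  proof (cases y x rule: linorder_cases)
    case less
    have "norm (F x - F (x - (x - y)) - (x - y) *\<^sub>R D) \<le> e * (x - y)"
      using less that by (intro scale d2) auto
    moreover have "F y - F x - (y - x) *\<^sub>R D = - (F x - F (x - (x - y)) - (x - y) *\<^sub>R D)"
      by (simp add: algebra_simps)
    ultimately show ?thesis using less by (metis abs_minus_commute abs_of_pos diff_gt_0_iff_gt norm_minus_cancel real_norm_def)
  next
    case greater
    have "norm (F (x + (y - x)) - F x - (y - x) *\<^sub>R D) \<le> e * (y - x)"
      using greater that by (intro scale d1) auto
    then show ?thesis using greater by simp
  qed simp
  then show "\<exists>d>0. \<forall>y. norm (y - x) < d \<longrightarrow> norm (F y - F x - (y - x) *\<^sub>R D) \<le> e * norm (y - x)"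
    using d1(1) d2(1) by (intro exI[of _ "min d1 d2"]) auto
qed (rule bounded_linear_scaleR_left)

text \<open>Lebesgue's differentiation theorem. Averages to the right come from \<open>f\<close>,
  those to the left from the reflected function \<open>\<lambda>x. f (-x)\<close>; the exceptional
  set is the union of the first null set with the reflection of the second.\<close>

lemma indefinite_integral_ae_derivative:
  fixes F :: "real \<Rightarrow> 'b::euclidean_space"
  assumes F: "\<And>a b. a \<le> b \<Longrightarrow> (f has_integral (F b - F a)) {a..b}"
  obtains N where "negligible N" "\<And>x. x \<notin> N \<Longrightarrow> (F has_vector_derivative f x) (at x)"
proof -
  have int: "f integrable_on cbox a b" for a b
    using F[of a b] by (cases "a \<le> b") (auto simp: integrable_on_def)
  have refl: "((\<lambda>x. f (-x)) has_integral (F (-a) - F (-b))) {a..b}" if "a \<le> b" for a b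
    using has_integral_reflect_lemma_real[OF F[of "-b" "-a"]] that by simp
  have int': "(\<lambda>x. f (-x)) integrable_on cbox a b" for a b
    using refl[of a b] by (cases "a \<le> b") (auto simp: integrable_on_def)
  obtain N1 where N1: "negligible N1"
    "\<And>x e. x \<notin> N1 \<Longrightarrow> 0 < e \<Longrightarrow> \<exists>d>0. \<forall>h. 0 < h \<and> h < d \<longrightarrow>
       norm (integral (cbox x (x + h *\<^sub>R One)) f /\<^sub>R h ^ DIM(real) - f x) < e"
    using integrable_ccontinuous_explicit[OF int] by blast
  obtain N2 where N2: "negligible N2"
    "\<And>x e. x \<notin> N2 \<Longrightarrow> 0 < e \<Longrightarrow> \<exists>d>0. \<forall>h. 0 < h \<and> h < d \<longrightarrow>
       norm (integral (cbox x (x + h *\<^sub>R One)) (\<lambda>x. f (-x)) /\<^sub>R h ^ DIM(real) - f (-x)) < e"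
    using integrable_ccontinuous_explicit[OF int'] by blast
  show thesis
  proof
    have "negligible (uminus ` N2)"
      using N2(1) by (intro negligible_differentiable_image_negligible)
        (auto simp: differentiable_on_def intro!: differentiable_minus)
    then show "negligible (N1 \<union> uminus ` N2)"
      using N1(1) by (rule negligible_Un[rotated])
    fix x assume "x \<notin> N1 \<union> uminus ` N2"
    then have x: "x \<notin> N1" "-x \<notin> N2"
      using image_eqI[of x uminus "-x" N2] by auto
    have *: "integral {x..x + h} f = F (x + h) - F x"
      "integral {-x..-x + h} (\<lambda>x. f (-x)) = F x - F (x - h)" if "0 < h" for h
      using F[of x "x + h"] refl[of "-x" "-x + h"] that by (auto dest!: integral_unique)
    show "(F has_vector_derivative f x) (at x)"
    proof (rule has_vector_derivative_of_one_sided_quotients)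
      fix e :: real assume e: "0 < e"
      show "\<exists>d>0. \<forall>h. 0 < h \<and> h < d \<longrightarrow> norm ((F (x + h) - F x) /\<^sub>R h - f x) < e"
        using N1(2)[OF x(1) e] by (auto simp: *)
      show "\<exists>d>0. \<forall>h. 0 < h \<and> h < d \<longrightarrow> norm ((F x - F (x - h)) /\<^sub>R h - f x) < e"
        using N2(2)[OF x(2) e] by (simp add: *(2)[simplified] cong: conj_cong imp_cong)
    qed
  qed
qed

text \<open>By continuity of \<open>G\<close> single points have no mass, so the value on the closed
  interval carries over. Open intervals are needed because Lebesgue measure is identified below by
  its values on boxes.\<close>

lemma emeasure_interval_measure_box:
  fixes G :: "real \<Rightarrow> real"
  assumes "a \<le> b" "mono G" "continuous_on UNIV G"
  shows "emeasure (interval_measure G) {a<..<b} = ennreal (G b - G a)"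
proof (cases "a = b")
  case False
  with \<open>a \<le> b\<close> have ab: "a < b" by simp
  let ?M = "interval_measure G"
  have Icc: "emeasure ?M {c..d} = ennreal (G d - G c)" if "c \<le> d" for c d
    using that assms by (intro emeasure_interval_measure_Icc) (auto dest: monoD)
  have sing: "emeasure ?M {c} = 0" for c
    using Icc[of c c] by simp
  have "emeasure ?M ({a..b} - {a, b}) = emeasure ?M {a..b}"
    using Icc[OF \<open>a \<le> b\<close>] by (intro emeasure_Diff_null_set) (auto simp: null_sets_def sing insert_commute
      intro!: emeasure_Un_null_set[of "{a}" ?M "{b}", simplified])
  moreover have "{a..b} - {a, b} = {a<..<b}"
    by auto
  ultimately show ?thesis
    using Icc[OF \<open>a \<le> b\<close>] by simp
qed simp

text \<open>The interval measures of \<open>G\<close> and of \<open>x - G x\<close> add up to Lebesgue measure, so both are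
  absolutely continuous.\<close>

lemma absolutely_continuous_interval_measure:
  fixes G :: "real \<Rightarrow> real"
  assumes G: "mono G" "mono (\<lambda>x. x - G x)" "continuous_on UNIV G"
  shows "absolutely_continuous lborel (interval_measure G)"
proof -
  let ?A = "interval_measure G" and ?B = "interval_measure (\<lambda>x. x - G x)"
  define \<mu> where "\<mu> X = emeasure ?A X + emeasure ?B X" for X
  define M where "M = measure_of UNIV (sets borel) \<mu>"
  have ca: "countably_additive (sets borel) \<mu>"
  proof (rule countably_additiveI)
    fix X :: "nat \<Rightarrow> real set"
    assume X: "range X \<subseteq> sets borel" "disjoint_family X"
    have "(\<Sum>i. emeasure ?A (X i)) = emeasure ?A (\<Union> (range X))"
      "(\<Sum>i. emeasure ?B (X i)) = emeasure ?B (\<Union> (range X))"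
      using X by (intro suminf_emeasure; simp)+
    then show "(\<Sum>i. \<mu> (X i)) = \<mu> (\<Union> (range X))"
      unfolding \<mu>_def by (subst suminf_add[symmetric]) auto
  qed
  have sets_M: "sets M = sets borel"
    unfolding M_def using sets.sigma_sets_eq[of "borel :: real measure"] by simp
  have em: "emeasure M X = \<mu> X" if "X \<in> sets borel" for X
    unfolding M_def using that ca
    by (intro emeasure_measure_of_sigma)
      (auto simp: positive_def \<mu>_def intro: sets.sigma_algebra_axioms[of borel, simplified])
  have "lborel = M"
  proof (rule lborel_eqI)
    fix l u :: real assume "\<And>b. b \<in> Basis \<Longrightarrow> l \<bullet> b \<le> u \<bullet> b"
    then have lu: "l \<le> u" by simp
    have "emeasure M {l<..<u} = ennreal (G u - G l) + ennreal (u - G u - (l - G l))"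
      unfolding em[OF borel_open[OF open_greaterThanLessThan]] \<mu>_def
      using lu G by (subst (1 2) emeasure_interval_measure_box) (auto intro!: continuous_intros)
    also have "\<dots> = ennreal (u - l)"
      using monoD[OF G(1) lu] monoD[OF G(2) lu] by (subst ennreal_plus[symmetric]) auto
    finally show "emeasure M (box l u) = (\<Prod>b\<in>Basis. (u - l) \<bullet> b)"
      by (simp add: box_real)
  qed (rule sets_M)
  then have "emeasure lborel X = \<mu> X" if "X \<in> sets borel" for X
    using em that by simp
  then show ?thesis
    unfolding absolutely_continuous_def by (auto simp: null_sets_def \<mu>_def)
qed

text \<open>The hypotheses together say \<open>0 \<le> G y - G x \<le> y - x\<close> for
  \<open>x \<le> y\<close>. The density is the Radon-Nikodym derivative of the interval measure of
  \<open>G\<close>.\<close>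

lemma mono_lipschitz_has_density:
  fixes G :: "real \<Rightarrow> real"
  assumes G: "mono G" "mono (\<lambda>x. x - G x)"
  obtains g where "\<And>x. 0 \<le> g x" "\<And>a b. a \<le> b \<Longrightarrow> (g has_integral (G b - G a)) {a..b}"
proof -
  have lip: "1-lipschitz_on UNIV G"
  proof (rule lipschitz_on_leI)
    fix x y :: real assume "x \<le> y"
    then show "dist (G x) (G y) \<le> 1 * dist x y"
      using monoD[OF G(1), of x y] monoD[OF G(2), of x y] by (simp add: dist_real_def)
  qed simp
  have cont: "continuous_on UNIV G"
    using lip by (rule lipschitz_on_continuous_on)
  obtain f where f: "f \<in> borel_measurable lborel" "density lborel f = interval_measure G"
    using sigma_finite_measure.Radon_Nikodym[OF sigma_finite_lborel absolutely_continuous_interval_measure[OF G cont]] by auto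
  note [measurable] = f(1)
  show thesis
  proof
    show "0 \<le> enn2real (f x)" for x by simp
    fix a b :: real assume ab: "a \<le> b"
    have "emeasure (density lborel f) {a..b} = ennreal (G b - G a)"
      unfolding f(2) using ab G cont by (intro emeasure_interval_measure_Icc) (auto dest: monoD)
    then have I: "(\<integral>\<^sup>+x. f x * indicator {a..b} x \<partial>lborel) = ennreal (G b - G a)"
      by (simp add: emeasure_density)
    \<comment> \<open>The density is \<open>ennreal\<close>-valued; its integral over the interval
      is finite, so \<open>enn2real\<close> changes it there only on a null set.\<close>
    then have "AE x in lborel. f x * indicator {a..b} x \<noteq> \<infinity>"
      by (intro nn_integral_PInf_AE) auto
    then have "(\<integral>\<^sup>+x. ennreal (enn2real (f x) * indicator {a..b} x) \<partial>lborel)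
        = (\<integral>\<^sup>+x. f x * indicator {a..b} x \<partial>lborel)"
      by (intro nn_integral_cong_AE, eventually_elim)
        (auto simp: indicator_def less_top split: if_splits)
    then have "((\<lambda>x. enn2real (f x) * indicator {a..b} x) has_integral (G b - G a)) UNIV"
      using I monoD[OF G(1) ab] by (intro nn_integral_has_integral) auto
    then have "((\<lambda>x. if x \<in> {a..b} then enn2real (f x) else 0) has_integral (G b - G a)) UNIV"
      by (rule has_integral_eq[rotated]) auto
    then show "((\<lambda>x. enn2real (f x)) has_integral (G b - G a)) {a..b}"
      by (simp only: has_integral_restrict_UNIV)
  qed
qed

text \<open>An affine change reduces this to the monotone case: adding \<open>K * x\<close> makes
  \<open>F\<close> increasing, and dividing by \<open>2 * K\<close> brings the slopes into
  \<open>[0, 1]\<close>.\<close>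

lemma lipschitz_real_has_density:
  fixes F :: "real \<Rightarrow> real"
  assumes F: "L-lipschitz_on UNIV F"
  obtains f where "\<And>a b. a \<le> b \<Longrightarrow> f absolutely_integrable_on {a..b}"
    "\<And>a b. a \<le> b \<Longrightarrow> (f has_integral (F b - F a)) {a..b}"
proof -
  \<comment> \<open>\<open>L\<close> may be 0, while the normalisation divides by the
    constant.\<close>
  define K where "K = L + 1"
  have K: "0 < K" "L \<le> K"
    using lipschitz_on_nonneg[OF F] by (auto simp: K_def)
  define G where "G x = (F x + K * x) / (2 * K)" for x
  have lip: "\<bar>F y - F x\<bar> \<le> K * (y - x)" if "x \<le> y" for x y
  proof -
    have "\<bar>F y - F x\<bar> \<le> L * (y - x)"
      using lipschitz_onD[OF F, of y x] that by (simp add: dist_real_def)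
    also have "\<dots> \<le> K * (y - x)"
      using K that by (intro mult_right_mono) auto
    finally show ?thesis .
  qed
  have "mono G" "mono (\<lambda>x. x - G x)"
  proof (rule_tac [!] monoI)
    fix x y :: real assume "x \<le> y"
    note * = lip[OF this]
    have "F x + K * x \<le> F y + K * y"
      using * by (simp add: algebra_simps)
    then show "G x \<le> G y"
      using K by (simp add: G_def divide_right_mono)
    have "x - G x = (K * x - F x) / (2 * K)" "y - G y = (K * y - F y) / (2 * K)"
      using K by (simp_all add: G_def field_simps)
    moreover have "K * x - F x \<le> K * y - F y"
      using * by (simp add: algebra_simps)
    ultimately show "x - G x \<le> y - G y"
      using K by (simp add: divide_right_mono)
  qed
  then obtain g where g: "\<And>x. 0 \<le> g x" "\<And>a b. a \<le> b \<Longrightarrow> (g has_integral (G b - G a)) {a..b}"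
    by (rule mono_lipschitz_has_density) blast
  show thesis
  proof
    fix a b :: real assume ab: "a \<le> b"
    have "((\<lambda>x. 2 * K * g x - K) has_integral (2 * K * (G b - G a) - K * (b - a))) {a..b}"
      using has_integral_diff[OF has_integral_mult_right[OF g(2)[OF ab], of "2 * K"]
        has_integral_const_real[of K a b]] ab by (simp add: mult.commute)
    moreover have "2 * K * (G b - G a) - K * (b - a) = F b - F a"
    proof -
      have "2 * K * G x = F x + K * x" for x
        using K by (simp add: G_def)
      then show ?thesis by (simp add: algebra_simps)
    qed
    ultimately show "((\<lambda>x. 2 * K * g x - K) has_integral (F b - F a)) {a..b}"
      by simp
    have "g absolutely_integrable_on {a..b}"
      using g ab by (intro nonnegative_absolutely_integrable_1) (auto simp: integrable_on_def)
    then show "(\<lambda>x. 2 * K * g x - K) absolutely_integrable_on {a..b}"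
      by (intro set_integral_diff set_integrable_mult_right)
        (auto intro: absolutely_integrable_continuous_real)
  qed
qed

text \<open>Coordinate by coordinate. Absolute integrability is carried along because the
  measurability and the domination of the speed of a curve are later drawn from it.\<close>

lemma lipschitz_has_density:
  fixes F :: "real \<Rightarrow> 'b::euclidean_space"
  assumes F: "L-lipschitz_on UNIV F"
  obtains f where "\<And>a b. a \<le> b \<Longrightarrow> f absolutely_integrable_on {a..b}"
    "\<And>a b. a \<le> b \<Longrightarrow> (f has_integral (F b - F a)) {a..b}"
proof -
  have lip: "L-lipschitz_on UNIV (\<lambda>x. F x \<bullet> i)" if "i \<in> Basis" for i
  proof (rule lipschitz_onI)
    fix x y
    have "dist (F x \<bullet> i) (F y \<bullet> i) \<le> dist (F x) (F y)"
      using that Basis_le_norm[of i "F x - F y"] by (simp add: dist_norm inner_diff_left)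
    then show "dist (F x \<bullet> i) (F y \<bullet> i) \<le> L * dist x y"
      using lipschitz_onD[OF F, of x y] by simp
  qed (rule lipschitz_on_nonneg[OF F])
  have "\<forall>i\<in>Basis. \<exists>f. \<forall>a b. a \<le> b \<longrightarrow> f absolutely_integrable_on {a..b} \<and>
      (f has_integral (F b \<bullet> i - F a \<bullet> i)) {a..b}"
  proof
    fix i :: 'b assume "i \<in> Basis"
    then obtain f where "\<And>a b. a \<le> b \<Longrightarrow> f absolutely_integrable_on {a..b}"
      "\<And>a b. a \<le> b \<Longrightarrow> (f has_integral (F b \<bullet> i - F a \<bullet> i)) {a..b}"
      using lipschitz_real_has_density[OF lip] by metis
    then show "\<exists>f. \<forall>a b. a \<le> b \<longrightarrow> f absolutely_integrable_on {a..b} \<and>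
        (f has_integral (F b \<bullet> i - F a \<bullet> i)) {a..b}"
      by (intro exI[of _ f]) simp
  qed
  then have "\<exists>f. \<forall>i\<in>Basis. \<forall>a b. a \<le> b \<longrightarrow> f i absolutely_integrable_on {a..b} \<and>
      (f i has_integral (F b \<bullet> i - F a \<bullet> i)) {a..b}"
    by (rule bchoice)
  then obtain f where "\<forall>i\<in>Basis. \<forall>a b. a \<le> b \<longrightarrow> f i absolutely_integrable_on {a..b} \<and>
      (f i has_integral (F b \<bullet> i - F a \<bullet> i)) {a..b}" ..
  then have f: "f i absolutely_integrable_on {a..b}"
      "(f i has_integral (F b \<bullet> i - F a \<bullet> i)) {a..b}" if "i \<in> Basis" "a \<le> b" for i a b
    using that by simp_all
  have comp: "(\<lambda>x. (\<Sum>i\<in>Basis. f i x *\<^sub>R i) \<bullet> j) = f j" if "j \<in> Basis" for j :: 'b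
    using that by (simp add: fun_eq_iff inner_sum_left_Basis)
  show thesis
  proof
    fix a b :: real assume ab: "a \<le> b"
    show "(\<lambda>x. \<Sum>i\<in>Basis. f i x *\<^sub>R i) absolutely_integrable_on {a..b}"
    proof (rule absolutely_integrable_componentwise)
      fix j :: 'b assume "j \<in> Basis"
      then show "(\<lambda>x. (\<Sum>i\<in>Basis. f i x *\<^sub>R i) \<bullet> j) absolutely_integrable_on {a..b}"
        unfolding comp[OF \<open>j \<in> Basis\<close>] by (rule f(1)[OF _ ab])
    qed
    show "((\<lambda>x. \<Sum>i\<in>Basis. f i x *\<^sub>R i) has_integral (F b - F a)) {a..b}"
    proof (rule has_integral_componentwise)
      fix j :: 'b assume "j \<in> Basis"
      then show "((\<lambda>x. (\<Sum>i\<in>Basis. f i x *\<^sub>R i) \<bullet> j) has_integral (F b - F a) \<bullet> j) {a..b}"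
        unfolding comp[OF \<open>j \<in> Basis\<close>] inner_diff_left by (rule f(2)[OF _ ab])
    qed
  qed
qed

text \<open>\<open>F\<close> is extended by constants beyond the interval, which gives a Lipschitz
  function on the line. Its density is its derivative almost everywhere, hence agrees with
  \<open>vector_derivative F\<close> off a null set.\<close>

lemma lipschitz_on_interval_ae_derivative:
  fixes F :: "real \<Rightarrow> 'b::euclidean_space"
  assumes F: "L-lipschitz_on {a..b} F" and ab: "a \<le> b"
  obtains N where "negligible N" "a \<in> N" "b \<in> N"
    "\<And>t. t \<in> {a..b} - N \<Longrightarrow> (F has_vector_derivative vector_derivative F (at t)) (at t)"
    "(\<lambda>t. vector_derivative F (at t)) absolutely_integrable_on {a..b}"
    "((\<lambda>t. vector_derivative F (at t)) has_integral (F b - F a)) {a..b}"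
proof -
  \<comment> \<open>Clamping to \<open>{a..b}\<close> is a 1-Lipschitz retraction, so
    \<open>F (c t)\<close> keeps the constant \<open>L\<close>.\<close>
  define c where "c t = max a (min b t)" for t
  have c_in: "c t \<in> {a..b}" for t
    using ab by (auto simp: c_def)
  have c_id: "c t = t" if "t \<in> {a..b}" for t
    using that by (auto simp: c_def)
  have "L-lipschitz_on UNIV (\<lambda>t. F (c t))"
  proof (rule lipschitz_onI)
    fix x y
    have "dist (F (c x)) (F (c y)) \<le> L * dist (c x) (c y)"
      using F c_in by (intro lipschitz_onD) auto
    also have "\<dots> \<le> L * dist x y"
      using lipschitz_on_nonneg[OF F] by (intro mult_left_mono) (auto simp: c_def dist_real_def)
    finally show "dist (F (c x)) (F (c y)) \<le> L * dist x y" .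
  qed (rule lipschitz_on_nonneg[OF F])
  then obtain f where f: "\<And>s t. s \<le> t \<Longrightarrow> f absolutely_integrable_on {s..t}"
      "\<And>s t. s \<le> t \<Longrightarrow> (f has_integral (F (c t) - F (c s))) {s..t}"
    by (rule lipschitz_has_density) blast
  obtain N where N: "negligible N" "\<And>x. x \<notin> N \<Longrightarrow> ((\<lambda>t. F (c t)) has_vector_derivative f x) (at x)"
    using indefinite_integral_ae_derivative[of f "\<lambda>t. F (c t)"] f(2) by blast
  \<comment> \<open>\<open>F\<close> and its extension are known to agree only on the interval, so
    their two-sided derivatives can be compared only in its interior.\<close>
  let ?N = "N \<union> {a, b}"
  have deriv: "(F has_vector_derivative f t) (at t)" if "t \<in> {a..b} - ?N" for t
  proof (rule has_vector_derivative_transform_within_open)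
    show "((\<lambda>t. F (c t)) has_vector_derivative f t) (at t)" "open {a<..<b}" "t \<in> {a<..<b}"
      using N(2) that by auto
  qed (simp add: c_id)
  have eq: "vector_derivative F (at t) = f t" if "t \<in> {a..b} - ?N" for t
    using deriv[OF that] by (rule vector_derivative_at)
  have neg: "negligible ?N"
    using N(1) by (auto simp: negligible_Un_eq)
  show thesis
  proof
    show "negligible ?N" by (rule neg)
    show "(F has_vector_derivative vector_derivative F (at t)) (at t)" if "t \<in> {a..b} - ?N" for t
      using deriv[OF that] eq[OF that] by simp
    show "(\<lambda>t. vector_derivative F (at t)) absolutely_integrable_on {a..b}"
      by (rule absolutely_integrable_spike[OF f(1)[OF ab] neg eq])
    show "((\<lambda>t. vector_derivative F (at t)) has_integral (F b - F a)) {a..b}"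
      using f(2)[OF ab] c_id ab by (intro has_integral_spike[OF neg eq]) auto
  qed auto
qed

subsection \<open>The speed along a curve\<close>

text \<open>Both integrands are reset to 0 on \<open>N\<close>, which leaves the integrals alone and
  makes the bound hold everywhere on \<open>S\<close>.\<close>

lemma has_integral_norm_le_ae:
  fixes f :: "'n::euclidean_space \<Rightarrow> 'a::banach"
  assumes "(f has_integral i) S" "(g has_integral j) S" "negligible N"
    and le: "\<And>t. t \<in> S - N \<Longrightarrow> norm (f t) \<le> g t"
  shows "norm i \<le> j"
proof -
  have "((\<lambda>t. if t \<in> N then 0 else f t) has_integral i) S"
    "((\<lambda>t. if t \<in> N then 0 else g t) has_integral j) S"
    using assms(1,2) by (auto intro: has_integral_spike[OF \<open>negligible N\<close>])
  then show ?thesis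
    using le integral_norm_bound_integral[of "\<lambda>t. if t \<in> N then 0 else f t" S "\<lambda>t. if t \<in> N then 0 else g t"]
    by (auto simp: has_integral_iff)
qed

text \<open>Both first-order expansions are evaluated at one small step \<open>h\<close>, each with
  error at most \<open>e / 2 * h\<close>; division by \<open>h\<close> leaves the total error
  \<open>e\<close>.\<close>

lemma norm_vector_derivative_mono:
  fixes f :: "real \<Rightarrow> 'a::real_normed_vector" and g :: "real \<Rightarrow> 'b::real_normed_vector"
  assumes f: "(f has_vector_derivative D) (at t)" and g: "(g has_vector_derivative E) (at t)"
    and S: "open S" "t \<in> S"
    and le: "\<And>s. s \<in> S \<Longrightarrow> norm (g s - g t) \<le> norm (f s - f t)"
  shows "norm E \<le> norm D"
proof (rule field_le_epsilon)
  fix e :: real assume "0 < e"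
  then have e: "0 < e / 2" by simp
  obtain d1 where d1: "0 < d1"
    "\<And>s. norm (s - t) < d1 \<Longrightarrow> norm (f s - f t - (s - t) *\<^sub>R D) \<le> e / 2 * norm (s - t)"
    using f e unfolding has_vector_derivative_def has_derivative_at_alt by metis
  obtain d2 where d2: "0 < d2"
    "\<And>s. norm (s - t) < d2 \<Longrightarrow> norm (g s - g t - (s - t) *\<^sub>R E) \<le> e / 2 * norm (s - t)"
    using g e unfolding has_vector_derivative_def has_derivative_at_alt by metis
  obtain d3 where d3: "0 < d3" "\<And>s. norm (s - t) < d3 \<Longrightarrow> s \<in> S"
    using S by (metis dist_norm open_dist)
  define h where "h = min d1 (min d2 d3) / 2"
  have h: "0 < h" "h < d1" "h < d2" "h < d3"
    using d1(1) d2(1) d3(1) by (auto simp: h_def)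
  have "h * norm E = norm (h *\<^sub>R E)"
    using h by simp
  also have "\<dots> \<le> norm (g (t + h) - g t) + e / 2 * h"
    using d2(2)[of "t + h"] h norm_triangle_ineq4[of "g (t + h) - g t" "g (t + h) - g t - h *\<^sub>R E"] by simp
  also have "norm (g (t + h) - g t) \<le> norm (f (t + h) - f t)"
    using d3(2)[of "t + h"] h by (intro le) simp
  also have "\<dots> \<le> h * norm D + e / 2 * h"
    using d1(2)[of "t + h"] h norm_triangle_ineq[of "h *\<^sub>R D" "f (t + h) - f t - h *\<^sub>R D"] by simp
  finally have "h * norm E \<le> h * (norm D + e)"
    by (simp add: algebra_simps)
  then show "norm E \<le> norm D + e"
    using h by simp
qed

definition C1_path :: "real \<Rightarrow> real \<Rightarrow> (real \<Rightarrow> 'a::real_normed_vector) \<Rightarrow> (real \<Rightarrow> 'a) \<Rightarrow> bool" where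
  "C1_path a b z z' \<longleftrightarrow> a < b \<and>
     (\<forall>t\<in>{a..b}. (z has_vector_derivative z' t) (at t within {a..b})) \<and> continuous_on {a..b} z'"

lemma C1_path_lipschitz:
  assumes "C1_path a b z z'"
  obtains M where "M-lipschitz_on {a..b} z"
proof -
  have "bounded (z' ` {a..b})"
    using assms by (intro compact_imp_bounded compact_continuous_image) (auto simp: C1_path_def)
  then obtain M where M: "0 < M" "\<And>t. t \<in> {a..b} \<Longrightarrow> norm (z' t) \<le> M"
    unfolding bounded_pos by auto
  have "M-lipschitz_on {a..b} z"
  proof (rule bounded_derivative_imp_lipschitz)
    show "(z has_derivative (\<lambda>h. h *\<^sub>R z' t)) (at t within {a..b})" if "t \<in> {a..b}" for t
      using assms that by (auto simp: C1_path_def has_vector_derivative_def)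
    show "onorm (\<lambda>h. h *\<^sub>R z' t) \<le> M" if "t \<in> {a..b}" for t
    proof (rule onorm_le)
      fix h :: real
      show "norm (h *\<^sub>R z' t) \<le> M * norm h"
        using mult_left_mono[OF M(2)[OF that], of "\<bar>h\<bar>"] by (simp add: mult.commute)
    qed
  qed (use M in auto)
  then show thesis by (rule that)
qed

lemma C1_path_interior_derivative:
  assumes "C1_path a b z z'" "t \<in> {a<..<b}"
  shows "(z has_vector_derivative z' t) (at t)"
proof -
  have "(z has_vector_derivative z' t) (at t within {a..b})"
    using assms by (auto simp: C1_path_def)
  then show ?thesis
    using at_within_Icc_at[of a t b] assms(2) by simp
qed

text \<open>The derivative is taken at \<open>t\<close> and not within an interval, so that the
  speed depends only on the curve near \<open>t\<close>. This differs from the integrand of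
  \<open>curve_dist\<close> at most at the end points.\<close>

definition curve_speed ::
  "(real^'n \<Rightarrow> real^'m) \<Rightarrow> real^'m \<Rightarrow> (real \<Rightarrow> real^'n) \<Rightarrow> (real \<Rightarrow> real^'n) \<Rightarrow> real \<Rightarrow> real" where
  "curve_speed v w z z' t = sqrt ((norm (z' t))\<^sup>2 - (norm (vector_derivative (v \<circ> z) (at t)))\<^sup>2
     + (w \<bullet> vector_derivative (v \<circ> z) (at t))\<^sup>2)"

definition curve_lengths ::
  "(real^'n \<Rightarrow> real^'m) \<Rightarrow> real^'m \<Rightarrow> real^'n \<Rightarrow> real^'n \<Rightarrow> real set" where
  "curve_lengths v w x y =
     {integral {a..b} (curve_speed v w z z') | a b z z'. C1_path a b z z' \<and> z a = x \<and> z b = y}"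

text \<open>In the interior the filters \<open>at t within {a..b}\<close> and \<open>at t\<close>
  coincide, and the two end points do not affect an integral.\<close>

lemma curve_dist_eq_Inf: "curve_dist v w x y = Inf (curve_lengths v w x y)"
proof -
  have eq: "integral {a..b} (\<lambda>t. sqrt ((norm (z' t))\<^sup>2
        - (norm (vector_derivative (v \<circ> z) (at t within {a..b})))\<^sup>2
        + (w \<bullet> vector_derivative (v \<circ> z) (at t within {a..b}))\<^sup>2)) = integral {a..b} (curve_speed v w z z')"
    for a b :: real and z z'
    by (rule integral_spike[of "{a, b}"]) (auto simp: curve_speed_def at_within_Icc_at)
  show ?thesis
    unfolding curve_dist_def curve_lengths_def C1_path_def eq
    by (intro arg_cong[of _ _ Inf] Collect_cong) (simp only: conj_assoc)
qed

lemma pythagoras_unit: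
  fixes w V :: "'a::real_inner"
  assumes "norm w = 1"
  shows "(norm (V - (w \<bullet> V) *\<^sub>R w))\<^sup>2 = (norm V)\<^sup>2 - (w \<bullet> V)\<^sup>2"
proof -
  have "w \<bullet> w = 1"
    using assms by (simp add: dot_square_norm)
  then show ?thesis
    unfolding power2_norm_eq_inner
    by (simp add: inner_diff_left inner_diff_right inner_commute power2_eq_square algebra_simps)
qed

lemma curve_speed_eq:
  assumes "norm w = 1"
  shows "curve_speed v w z z' t = sqrt ((norm (z' t))\<^sup>2
    - (norm (vector_derivative (v \<circ> z) (at t) - (w \<bullet> vector_derivative (v \<circ> z) (at t)) *\<^sub>R w))\<^sup>2)"
  unfolding pythagoras_unit[OF assms] curve_speed_def by simp

text \<open>The bound by \<open>norm (z' t)\<close> holds because \<open>v\<close> does not increase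
  distances, so increments of \<open>v \<circ> z\<close> are dominated by those of \<open>z\<close>.
  With the end points in \<open>N\<close>, the two-sided derivative of \<open>z\<close> exists
  wherever it is compared.\<close>

lemma lipschitz_compose_C1_path:
  fixes v :: "real^'n \<Rightarrow> real^'m"
  assumes v: "1-lipschitz_on UNIV v" and z: "C1_path a b z z'"
  obtains N where "negligible N" "a \<in> N" "b \<in> N"
    "\<And>t. t \<in> {a..b} - N \<Longrightarrow> (v \<circ> z has_vector_derivative vector_derivative (v \<circ> z) (at t)) (at t)"
    "\<And>t. t \<in> {a..b} - N \<Longrightarrow> norm (vector_derivative (v \<circ> z) (at t)) \<le> norm (z' t)"
    "(\<lambda>t. vector_derivative (v \<circ> z) (at t)) absolutely_integrable_on {a..b}"
    "((\<lambda>t. vector_derivative (v \<circ> z) (at t)) has_integral (v (z b) - v (z a))) {a..b}"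
proof -
  obtain M where "M-lipschitz_on {a..b} z"
    using C1_path_lipschitz[OF z] .
  then have L: "(1 * M)-lipschitz_on {a..b} (v \<circ> z)"
    using lipschitz_on_subset[OF v] by (intro lipschitz_on_compose) auto
  have "a \<le> b"
    using z by (simp add: C1_path_def)
  obtain N where N: "negligible N" "a \<in> N" "b \<in> N"
    "\<And>t. t \<in> {a..b} - N \<Longrightarrow> (v \<circ> z has_vector_derivative vector_derivative (v \<circ> z) (at t)) (at t)"
    "(\<lambda>t. vector_derivative (v \<circ> z) (at t)) absolutely_integrable_on {a..b}"
    "((\<lambda>t. vector_derivative (v \<circ> z) (at t)) has_integral ((v \<circ> z) b - (v \<circ> z) a)) {a..b}"
    using lipschitz_on_interval_ae_derivative[OF L \<open>a \<le> b\<close>] by metis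
  have "norm (vector_derivative (v \<circ> z) (at t)) \<le> norm (z' t)" if t: "t \<in> {a..b} - N" for t
  proof (rule norm_vector_derivative_mono)
    have "t \<in> {a<..<b}"
      using t N(2,3) by (auto simp: less_le)
    then show "(z has_vector_derivative z' t) (at t)"
      by (rule C1_path_interior_derivative[OF z])
    show "norm ((v \<circ> z) s - (v \<circ> z) t) \<le> norm (z s - z t)" for s
      using lipschitz_on_normD[OF v, of "z s" "z t"] by simp
  qed (rule N(4)[OF t] open_UNIV UNIV_I)+
  with N show thesis
    by (intro that[of N]) auto
qed

text \<open>The speed is measurable and dominated by the sum of the norms of the three terms under
  the root.\<close>

lemma curve_speed_absolutely_integrable:
  assumes v: "1-lipschitz_on UNIV v" and z: "C1_path a b z z'"
  shows "curve_speed v w z z' absolutely_integrable_on {a..b}"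
proof (rule measurable_bounded_by_integrable_imp_absolutely_integrable)
  let ?V = "\<lambda>t. vector_derivative (v \<circ> z) (at t)"
  have V: "?V absolutely_integrable_on {a..b}"
    using lipschitz_compose_C1_path[OF v z] by metis
  have z': "continuous_on {a..b} z'"
    using z by (simp add: C1_path_def)
  have [measurable]: "?V \<in> borel_measurable (lebesgue_on {a..b})"
    using V by (rule absolutely_integrable_measurable[THEN iffD1, THEN conjunct1, rotated]) simp
  have [measurable]: "z' \<in> borel_measurable (lebesgue_on {a..b})"
    using z' by (intro continuous_imp_measurable_on_sets_lebesgue) auto
  show "curve_speed v w z z' \<in> borel_measurable (lebesgue_on {a..b})"
    unfolding curve_speed_def[abs_def] by measurable
  show "{a..b} \<in> sets lebesgue" by simp
  show "(\<lambda>t. norm (z' t) + norm (?V t) + norm (w \<bullet> ?V t)) integrable_on {a..b}"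
  proof (intro integrable_add)
    show "(\<lambda>t. norm (z' t)) integrable_on {a..b}"
      using z' by (intro integrable_continuous_real continuous_intros)
    show "(\<lambda>t. norm (?V t)) integrable_on {a..b}"
      using V by (simp add: absolutely_integrable_on_def)
    have "(\<lambda>t. w \<bullet> ?V t) absolutely_integrable_on {a..b}"
      using absolutely_integrable_linear[OF V bounded_linear_inner_right[of w]] by (simp add: o_def)
    then show "(\<lambda>t. norm (w \<bullet> ?V t)) integrable_on {a..b}"
      by (simp add: absolutely_integrable_on_def)
  qed
  fix t
  \<comment> \<open>The bound is required at every \<open>t\<close>, also where the radicand is
    negative. There \<open>sqrt\<close>, being an odd function, takes a negative value whose modulus
    is the root of the modulus.\<close>
  have "norm (curve_speed v w z z' t) = sqrt \<bar>(norm (z' t))\<^sup>2 - (norm (?V t))\<^sup>2 + (w \<bullet> ?V t)\<^sup>2\<bar>"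
    unfolding curve_speed_def real_norm_def
    by (cases "0 \<le> (norm (z' t))\<^sup>2 - (norm (?V t))\<^sup>2 + (w \<bullet> ?V t)\<^sup>2")
      (simp_all only: abs_of_nonneg abs_of_nonpos real_sqrt_ge_0_iff real_sqrt_le_0_iff
        not_le less_imp_le real_sqrt_minus)
  also have "\<dots> \<le> sqrt ((norm (z' t) + norm (?V t) + norm (w \<bullet> ?V t))\<^sup>2)"
  proof (rule real_sqrt_le_mono)
    have "(x + y + u)\<^sup>2 = x\<^sup>2 + y\<^sup>2 + u\<^sup>2 + 2 * (x * y + x * u + y * u)" for x y u :: real
      by (simp add: power2_eq_square algebra_simps)
    moreover have "0 \<le> norm (z' t) * norm (?V t) + norm (z' t) * norm (w \<bullet> ?V t) + norm (?V t) * norm (w \<bullet> ?V t)"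
      by simp
    ultimately have "(norm (z' t))\<^sup>2 + (norm (?V t))\<^sup>2 + (norm (w \<bullet> ?V t))\<^sup>2
        \<le> (norm (z' t) + norm (?V t) + norm (w \<bullet> ?V t))\<^sup>2"
      by simp
    moreover have "(norm (w \<bullet> ?V t))\<^sup>2 = (w \<bullet> ?V t)\<^sup>2"
      by simp
    moreover have "0 \<le> (norm (z' t))\<^sup>2" "0 \<le> (norm (?V t))\<^sup>2" "0 \<le> (w \<bullet> ?V t)\<^sup>2"
      by simp_all
    ultimately show "\<bar>(norm (z' t))\<^sup>2 - (norm (?V t))\<^sup>2 + (w \<bullet> ?V t)\<^sup>2\<bar>
        \<le> (norm (z' t) + norm (?V t) + norm (w \<bullet> ?V t))\<^sup>2"
      by linarith
  qed
  also have "\<dots> = norm (z' t) + norm (?V t) + norm (w \<bullet> ?V t)"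
    by (simp add: real_sqrt_abs)
  finally show "norm (curve_speed v w z z' t) \<le> norm (z' t) + norm (?V t) + norm (w \<bullet> ?V t)" .
qed

lemma curve_speed_has_integral:
  assumes "1-lipschitz_on UNIV v" "C1_path a b z z'"
  shows "(curve_speed v w z z' has_integral integral {a..b} (curve_speed v w z z')) {a..b}"
  using curve_speed_absolutely_integrable[OF assms]
  by (intro integrable_integral set_lebesgue_integral_eq_integral(1))

subsection \<open>Bounds on the curve distance\<close>

lemma has_integral_Pair:
  fixes f :: "'n::euclidean_space \<Rightarrow> 'a::euclidean_space" and g :: "'n \<Rightarrow> 'b::euclidean_space"
  assumes "(f has_integral i) S" "(g has_integral j) S"
  shows "((\<lambda>t. (f t, g t)) has_integral (i, j)) S"
proof -
  have "bounded_linear (\<lambda>x::'a. (x, 0::'b))" "bounded_linear (\<lambda>y::'b. (0::'a, y))"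
    by (intro bounded_linear_Pair bounded_linear_ident bounded_linear_zero)+
  then have "((\<lambda>t. (f t, 0) + (0, g t)) has_integral ((i, 0) + (0, j))) S"
    using assms by (intro has_integral_add) (auto dest: has_integral_linear simp: o_def)
  then show ?thesis by simp
qed

text \<open>Projection shortens the velocity of \<open>v \<circ> z\<close>, which is itself no
  longer than \<open>z'\<close> off a null set. Hence the radicand is nonnegative there and squaring
  undoes the root.\<close>

lemma curve_speed_ae_nonneg:
  assumes w: "norm w = 1" and v: "1-lipschitz_on UNIV v" and z: "C1_path a b z z'"
  obtains N where "negligible N"
    "\<And>t. t \<in> {a..b} - N \<Longrightarrow> 0 \<le> curve_speed v w z z' t"
    "\<And>t. t \<in> {a..b} - N \<Longrightarrow> (curve_speed v w z z' t)\<^sup>2 + (norm (vector_derivative (v \<circ> z) (at t)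
      - (w \<bullet> vector_derivative (v \<circ> z) (at t)) *\<^sub>R w))\<^sup>2 = (norm (z' t))\<^sup>2"
proof -
  obtain N where N: "negligible N"
    "\<And>t. t \<in> {a..b} - N \<Longrightarrow> norm (vector_derivative (v \<circ> z) (at t)) \<le> norm (z' t)"
    using lipschitz_compose_C1_path[OF v z] by metis
  let ?P = "\<lambda>t. norm (vector_derivative (v \<circ> z) (at t) - (w \<bullet> vector_derivative (v \<circ> z) (at t)) *\<^sub>R w)"
  have le: "(?P t)\<^sup>2 \<le> (norm (z' t))\<^sup>2" if "t \<in> {a..b} - N" for t
  proof -
    have "(?P t)\<^sup>2 \<le> (norm (vector_derivative (v \<circ> z) (at t)))\<^sup>2"
      unfolding pythagoras_unit[OF w] by simp
    also have "\<dots> \<le> (norm (z' t))\<^sup>2"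
      using N(2)[OF that] by (rule power_mono) simp
    finally show ?thesis .
  qed
  show thesis
  proof
    show "0 \<le> curve_speed v w z z' t" if "t \<in> {a..b} - N" for t
      unfolding curve_speed_eq[OF w] using le[OF that] by simp
    show "(curve_speed v w z z' t)\<^sup>2 + (?P t)\<^sup>2 = (norm (z' t))\<^sup>2" if "t \<in> {a..b} - N" for t
      unfolding curve_speed_eq[OF w] using le[OF that] by simp
  qed (rule N(1))
qed

lemma curve_lengths_nonneg:
  assumes w: "norm w = 1" and v: "1-lipschitz_on UNIV v" and "l \<in> curve_lengths v w x y"
  shows "0 \<le> l"
proof -
  obtain a b z z' where l: "l = integral {a..b} (curve_speed v w z z')" and z: "C1_path a b z z'"
    using assms(3) by (auto simp: curve_lengths_def)
  obtain N where "negligible N" "\<And>t. t \<in> {a..b} - N \<Longrightarrow> 0 \<le> curve_speed v w z z' t"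
    using curve_speed_ae_nonneg[OF w v z] by metis
  then have "norm (0::real) \<le> l"
    unfolding l by (intro has_integral_norm_le_ae[OF has_integral_0 curve_speed_has_integral[OF v z]]) auto
  then show ?thesis by simp
qed

lemma curve_dist_le:
  assumes "norm w = 1" "1-lipschitz_on UNIV v" "l \<in> curve_lengths v w x y"
  shows "curve_dist v w x y \<le> l"
  unfolding curve_dist_eq_Inf using assms curve_lengths_nonneg[OF assms(1,2)]
  by (intro cInf_lower) (auto simp: bdd_below_def)

text \<open>The speed and the projected velocity of \<open>v \<circ> z\<close> together form a vector of norm
  \<open>norm (y - x)\<close> along the segment; its integral has at most that norm.\<close>

lemma curve_dist_segment:
  fixes v :: "real^'n \<Rightarrow> real^'m"
  assumes w: "norm w = 1" and v: "1-lipschitz_on UNIV v"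
  obtains l where "l \<in> curve_lengths v w x y"
    "l\<^sup>2 + (norm (v y - v x - (w \<bullet> (v y - v x)) *\<^sub>R w))\<^sup>2 \<le> (norm (y - x))\<^sup>2"
proof -
  define z where "z t = x + t *\<^sub>R (y - x)" for t
  define z' where "z' t = y - x" for t :: real
  have z: "C1_path 0 1 z z'"
    unfolding C1_path_def z_def z'_def by (auto intro!: derivative_eq_intros)
  have ends: "z 0 = x" "z 1 = y"
    by (auto simp: z_def)
  let ?s = "curve_speed v w z z'"
  let ?V = "\<lambda>t. vector_derivative (v \<circ> z) (at t)"
  let ?l = "integral {0..1} ?s"
  obtain N where N: "negligible N"
    "\<And>t. t \<in> {0..1} - N \<Longrightarrow> (?s t)\<^sup>2 + (norm (?V t - (w \<bullet> ?V t) *\<^sub>R w))\<^sup>2 = (norm (z' t))\<^sup>2"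
    using curve_speed_ae_nonneg[OF w v z] by metis
  have V: "(?V has_integral (v y - v x)) {0..1}"
    using lipschitz_compose_C1_path[OF v z] unfolding ends by metis
  have "bounded_linear (\<lambda>V. V - (w \<bullet> V) *\<^sub>R w)"
    by (intro bounded_linear_sub bounded_linear_ident bounded_linear_scaleR_const bounded_linear_inner_right)
  from has_integral_linear[OF V this]
  have "((\<lambda>t. ?V t - (w \<bullet> ?V t) *\<^sub>R w) has_integral (v y - v x - (w \<bullet> (v y - v x)) *\<^sub>R w)) {0..1}"
    by (simp add: o_def)
  from has_integral_Pair[OF curve_speed_has_integral[OF v z] this]
  have "norm (?l, v y - v x - (w \<bullet> (v y - v x)) *\<^sub>R w) \<le> norm (y - x)"
  proof (rule has_integral_norm_le_ae[OF _ _ N(1)])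
    show "((\<lambda>t. norm (y - x)) has_integral norm (y - x)) {0..1::real}"
      using has_integral_const_real[of "norm (y - x)" 0 1] by simp
    show "norm (?s t, ?V t - (w \<bullet> ?V t) *\<^sub>R w) \<le> norm (y - x)" if "t \<in> {0..1} - N" for t
      using N(2)[OF that] by (simp add: norm_Pair z'_def)
  qed
  then have "(norm (?l, v y - v x - (w \<bullet> (v y - v x)) *\<^sub>R w))\<^sup>2 \<le> (norm (y - x))\<^sup>2"
    by (rule power_mono) simp
  then have "?l\<^sup>2 + (norm (v y - v x - (w \<bullet> (v y - v x)) *\<^sub>R w))\<^sup>2 \<le> (norm (y - x))\<^sup>2"
    by (simp add: norm_Pair)
  moreover have "?l \<in> curve_lengths v w x y"
    using z ends unfolding curve_lengths_def by blast
  ultimately show thesis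
    using that by blast
qed

text \<open>Lower bounds for the infimum of a set of reals require a member, here the length of the
  segment.\<close>

lemma curve_lengths_nonempty:
  assumes "norm w = 1" "1-lipschitz_on UNIV v"
  shows "curve_lengths v w x y \<noteq> {}"
  using curve_dist_segment[OF assms] by (metis empty_iff)

lemma curve_dist_nonneg:
  assumes "norm w = 1" "1-lipschitz_on UNIV v"
  shows "0 \<le> curve_dist v w x y"
  unfolding curve_dist_eq_Inf
  using assms by (intro cInf_greatest curve_lengths_nonempty curve_lengths_nonneg)

lemma curve_dist_upper:
  fixes v :: "real^'n \<Rightarrow> real^'m"
  assumes w: "norm w = 1" and v: "1-lipschitz_on UNIV v"
  shows "(curve_dist v w x y)\<^sup>2 + (norm (v y - v x - (w \<bullet> (v y - v x)) *\<^sub>R w))\<^sup>2 \<le> (norm (y - x))\<^sup>2"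
proof -
  obtain l where l: "l \<in> curve_lengths v w x y"
    "l\<^sup>2 + (norm (v y - v x - (w \<bullet> (v y - v x)) *\<^sub>R w))\<^sup>2 \<le> (norm (y - x))\<^sup>2"
    using curve_dist_segment[OF w v] .
  have "(curve_dist v w x y)\<^sup>2 \<le> l\<^sup>2"
    using curve_dist_le[OF w v l(1)] curve_dist_nonneg[OF w v] by (rule power_mono)
  then show ?thesis
    using l(2) by linarith
qed

lemma curve_dist_self:
  assumes "norm w = 1" "1-lipschitz_on UNIV v"
  shows "curve_dist v w x x = 0"
  using curve_dist_upper[OF assms, of x x] by (simp add: inner_zero_right)

text \<open>This is the necessity of the condition. Since \<open>u\<close> and \<open>v\<close> have
  the same projection, a curve has almost everywhere the same speed for both; for \<open>u\<close>
  the speed dominates the \<open>w\<close>-component of the velocity because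
  \<open>norm (?U t) \<le> norm (z' t)\<close>.\<close>

lemma curve_dist_lower:
  fixes v :: "real^'n \<Rightarrow> real^'m"
  assumes w: "norm w = 1" and v: "1-lipschitz_on UNIV v" and u: "1-lipschitz_on UNIV u"
    and vu: "\<And>x. v x - u x \<in> span {w}"
  shows "\<bar>(u x - u y) \<bullet> w\<bar> \<le> curve_dist v w x y"
  unfolding curve_dist_eq_Inf
proof (rule cInf_greatest[OF curve_lengths_nonempty[OF w v]])
  fix l assume "l \<in> curve_lengths v w x y"
  then obtain a b z z' where l: "l = integral {a..b} (curve_speed v w z z')"
      and z: "C1_path a b z z'" and ends: "z a = x" "z b = y"
    by (auto simp: curve_lengths_def)
  let ?P = "\<lambda>V. V - (w \<bullet> V) *\<^sub>R w"
  have P: "bounded_linear ?P"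
    by (intro bounded_linear_sub bounded_linear_ident bounded_linear_scaleR_const bounded_linear_inner_right)
  have "w \<bullet> w = 1"
    using w by (simp add: dot_square_norm)
  have Peq: "?P (v x) = ?P (u x)" for x
  proof -
    obtain c where "v x - u x = c *\<^sub>R w"
      using vu[of x] by (auto simp: span_singleton)
    then have "v x = u x + c *\<^sub>R w"
      by (simp add: algebra_simps)
    then show ?thesis
      using \<open>w \<bullet> w = 1\<close> by (simp add: inner_add_right algebra_simps)
  qed
  let ?V = "\<lambda>t. vector_derivative (v \<circ> z) (at t)"
  let ?U = "\<lambda>t. vector_derivative (u \<circ> z) (at t)"
  obtain N1 where N1: "negligible N1"
    "\<And>t. t \<in> {a..b} - N1 \<Longrightarrow> (v \<circ> z has_vector_derivative ?V t) (at t)"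
    using lipschitz_compose_C1_path[OF v z] by metis
  obtain N2 where N2: "negligible N2"
    "\<And>t. t \<in> {a..b} - N2 \<Longrightarrow> (u \<circ> z has_vector_derivative ?U t) (at t)"
    "\<And>t. t \<in> {a..b} - N2 \<Longrightarrow> norm (?U t) \<le> norm (z' t)"
    "(?U has_integral (u (z b) - u (z a))) {a..b}"
    using lipschitz_compose_C1_path[OF u z] by metis
  have "norm (w \<bullet> (u (z b) - u (z a))) \<le> l"
    unfolding l
  proof (rule has_integral_norm_le_ae[OF _ curve_speed_has_integral[OF v z]])
    show "((\<lambda>t. w \<bullet> ?U t) has_integral (w \<bullet> (u (z b) - u (z a)))) {a..b}"
      using has_integral_linear[OF N2(4) bounded_linear_inner_right[of w]] by (simp add: o_def)
    show "negligible (N1 \<union> N2)"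
      using N1(1) N2(1) by (rule negligible_Un)
    fix t assume t: "t \<in> {a..b} - (N1 \<union> N2)"
    have "((\<lambda>t. ?P (v (z t))) has_vector_derivative ?P (?V t)) (at t)"
      using bounded_linear.has_vector_derivative[OF P N1(2)] t by (simp add: o_def)
    moreover have "((\<lambda>t. ?P (u (z t))) has_vector_derivative ?P (?U t)) (at t)"
      using bounded_linear.has_vector_derivative[OF P N2(2)] t by (simp add: o_def)
    \<comment> \<open>By \<open>Peq\<close> both are derivatives of one and the same
      function.\<close>
    ultimately have "?P (?V t) = ?P (?U t)"
      unfolding Peq by (rule vector_derivative_unique_at)
    then have "curve_speed v w z z' t = sqrt ((norm (z' t))\<^sup>2 - (norm (?P (?U t)))\<^sup>2)"
      unfolding curve_speed_eq[OF w] by simp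
    also have "\<dots> = sqrt ((norm (z' t))\<^sup>2 - (norm (?U t))\<^sup>2 + (w \<bullet> ?U t)\<^sup>2)"
      unfolding pythagoras_unit[OF w] by simp
    finally have "curve_speed v w z z' t = sqrt ((norm (z' t))\<^sup>2 - (norm (?U t))\<^sup>2 + (w \<bullet> ?U t)\<^sup>2)" .
    moreover have "(norm (?U t))\<^sup>2 \<le> (norm (z' t))\<^sup>2"
      using N2(3)[of t] t by (intro power_mono) auto
    ultimately show "norm (w \<bullet> ?U t) \<le> curve_speed v w z z' t"
      by (simp add: real_le_rsqrt)
  qed
  then show "\<bar>(u x - u y) \<bullet> w\<bar> \<le> l"
    unfolding ends by (simp add: inner_commute inner_diff_right abs_minus_commute)
qed

subsection \<open>The triangle inequality\<close>

text \<open>Reparametrising by \<open>(1 - cos (\<pi> s)) / 2\<close> makes the velocity vanish at both ends, so that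
  concatenations stay continuously differentiable.\<close>

lemma C1_path_reparametrize:
  fixes v :: "real^'n \<Rightarrow> real^'m" and c :: real
  assumes v: "1-lipschitz_on UNIV v" and z: "C1_path a b z z'"
  obtains y y' where "C1_path c (c + 1) y y'" "y c = z a" "y (c + 1) = z b"
    "y' c = 0" "y' (c + 1) = 0"
    "integral {c..c + 1} (curve_speed v w y y') = integral {a..b} (curve_speed v w z z')"
proof -
  have ab: "a < b"
    using z by (simp add: C1_path_def)
  define \<sigma> where "\<sigma> s = a + (b - a) * ((1 - cos (pi * (s - c))) / 2)" for s
  define \<sigma>' where "\<sigma>' s = (b - a) * (pi * sin (pi * (s - c)) / 2)" for s
  \<comment> \<open>\<open>g\<close> inverts \<open>\<sigma>\<close>. It yields injectivity, and it
    carries the exceptional set of \<open>v \<circ> z\<close> back to the new parameter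
    interval.\<close>
  define g where "g t = c + arccos (1 - 2 * ((t - a) / (b - a))) / pi" for t
  have ends: "\<sigma> c = a" "\<sigma> (c + 1) = b" "\<sigma>' c = 0" "\<sigma>' (c + 1) = 0"
    by (auto simp: \<sigma>_def \<sigma>'_def)
  have der: "(\<sigma> has_real_derivative \<sigma>' s) (at s within S)" for s S
    unfolding \<sigma>_def \<sigma>'_def by (auto intro!: derivative_eq_intros)
  have \<sigma>_Icc: "\<sigma> s \<in> {a..b}" for s
  proof -
    have "0 \<le> (1 - cos (pi * (s - c))) / 2" "(1 - cos (pi * (s - c))) / 2 \<le> 1"
      using cos_ge_minus_one[of "pi * (s - c)"] by auto
    then have "0 \<le> (b - a) * ((1 - cos (pi * (s - c))) / 2)"
      "(b - a) * ((1 - cos (pi * (s - c))) / 2) \<le> (b - a) * 1"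
      using ab by (intro mult_nonneg_nonneg mult_left_mono; simp)+
    then show ?thesis
      by (simp add: \<sigma>_def)
  qed
  have \<sigma>'_pos: "0 < \<sigma>' s" if "s \<in> {c<..<c + 1}" for s
    unfolding \<sigma>'_def using that ab
    by (intro mult_pos_pos divide_pos_pos sin_gt_zero) auto
  have g_\<sigma>: "g (\<sigma> s) = s" if "s \<in> {c..c + 1}" for s
  proof -
    have "1 - 2 * ((1 - C) / 2) = C" for C :: real
      by (simp add: field_simps)
    moreover have "(\<sigma> s - a) / (b - a) = (1 - cos (pi * (s - c))) / 2"
      unfolding \<sigma>_def add_diff_cancel_left' using ab by (intro nonzero_mult_div_cancel_left) simp
    ultimately have "1 - 2 * ((\<sigma> s - a) / (b - a)) = cos (pi * (s - c))"
      by (simp only:)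
    moreover have "arccos (cos (pi * (s - c))) = pi * (s - c)"
      using that by (intro arccos_cos) auto
    ultimately show ?thesis
      by (simp add: g_def)
  qed
  have inj: "inj_on \<sigma> {c<..<c + 1}"
    by (rule inj_on_inverseI[of _ g]) (simp add: g_\<sigma>)
  have arg: "-1 < 1 - 2 * ((t - a) / (b - a))" "1 - 2 * ((t - a) / (b - a)) < 1"
    if "t \<in> {a<..<b}" for t
    using that by (auto simp: field_simps)
  have \<sigma>_g: "\<sigma> (g t) = t" "g t \<in> {c<..<c + 1}" if "t \<in> {a<..<b}" for t
  proof -
    let ?q = "1 - 2 * ((t - a) / (b - a))"
    have "cos (pi * (g t - c)) = ?q"
      using arg[OF that] by (simp add: g_def)
    moreover have "(1 - (1 - 2 * r)) / 2 = r" for r :: real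
      by simp
    ultimately have "\<sigma> (g t) = a + (b - a) * ((t - a) / (b - a))"
      unfolding \<sigma>_def by (simp only:)
    then show "\<sigma> (g t) = t"
      using ab by simp
    have "0 < arccos ?q" "arccos ?q < pi"
      using arccos_lt_bounded[OF arg[OF that]] by auto
    then show "g t \<in> {c<..<c + 1}"
      by (simp add: g_def)
  qed
  have \<sigma>_Ioo: "\<sigma> s \<in> {a<..<b}" if s: "s \<in> {c<..<c + 1}" for s
  proof -
    have "\<sigma> s \<noteq> a" "\<sigma> s \<noteq> b"
      using g_\<sigma>[of s] g_\<sigma>[of c] g_\<sigma>[of "c + 1"] s ends by auto
    then show ?thesis
      using \<sigma>_Icc[of s] by auto
  qed
  have image: "\<sigma> ` {c<..<c + 1} = {a<..<b}"
  proof (intro equalityI subsetI)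
    fix t assume "t \<in> {a<..<b}"
    from \<sigma>_g[OF this] show "t \<in> \<sigma> ` {c<..<c + 1}"
      by (metis imageI)
  qed (use \<sigma>_Ioo in blast)

  define y where "y = z \<circ> \<sigma>"
  define y' where "y' s = \<sigma>' s *\<^sub>R z' (\<sigma> s)" for s
  have cont_\<sigma>: "continuous_on S \<sigma>" for S
    unfolding \<sigma>_def by (intro continuous_intros) auto
  have path: "C1_path c (c + 1) y y'"
    unfolding C1_path_def
  proof (intro conjI ballI)
    fix s assume "s \<in> {c..c + 1}"
    have "(z has_vector_derivative z' (\<sigma> s)) (at (\<sigma> s) within {a..b})"
      using z \<sigma>_Icc[of s] by (auto simp: C1_path_def)
    then have "(z has_vector_derivative z' (\<sigma> s)) (at (\<sigma> s) within \<sigma> ` {c..c + 1})"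
      by (rule has_vector_derivative_within_subset) (use \<sigma>_Icc in blast)
    then show "(y has_vector_derivative y' s) (at s within {c..c + 1})"
      unfolding y_def y'_def using der[unfolded has_real_derivative_iff_has_vector_derivative]
      by (intro vector_diff_chain_within)
  next
    have "continuous_on {c..c + 1} (z' \<circ> \<sigma>)"
      using z \<sigma>_Icc by (intro continuous_on_compose cont_\<sigma>) (auto simp: C1_path_def intro: continuous_on_subset)
    moreover have "continuous_on {c..c + 1} \<sigma>'"
      unfolding \<sigma>'_def by (intro continuous_intros) auto
    ultimately show "continuous_on {c..c + 1} y'"
      unfolding y'_def o_def by (intro continuous_intros)
  qed simp

  let ?V = "\<lambda>t. vector_derivative (v \<circ> z) (at t)"
  obtain N where N: "negligible N" "\<And>t. t \<in> {a..b} - N \<Longrightarrow> (v \<circ> z has_vector_derivative ?V t) (at t)"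
    using lipschitz_compose_C1_path[OF v z] by metis
  \<comment> \<open>A differentiable map sends null sets to null sets, so the parameters that
    \<open>\<sigma>\<close> sends into \<open>N\<close> are negligible.\<close>
  have "g differentiable_on {a<..<b}"
    unfolding differentiable_on_def
  proof
    fix t assume "t \<in> {a<..<b}"
    from DERIV_arccos[OF arg[OF this]]
    have "(arccos has_real_derivative inverse (- sqrt (1 - (1 - 2 * ((t - a) / (b - a)))\<^sup>2)))
        (at (1 - 2 * ((t - a) / (b - a))))" .
    then have "arccos differentiable (at (1 - 2 * ((t - a) / (b - a))))"
      unfolding real_differentiable_def by blast
    moreover have "(\<lambda>t. 1 - 2 * ((t - a) / (b - a))) differentiable (at t)"
      using ab by (intro derivative_intros) auto
    ultimately have "(\<lambda>t. arccos (1 - 2 * ((t - a) / (b - a)))) differentiable (at t)"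
      using differentiable_chain_at[of "\<lambda>t. 1 - 2 * ((t - a) / (b - a))" t arccos] by (simp add: o_def)
    then have "g differentiable at t"
      unfolding g_def by (intro differentiable_add differentiable_divide) auto
    then show "g differentiable at t within {a<..<b}"
      by (rule differentiable_at_withinI)
  qed
  then have "negligible (g ` (N \<inter> {a<..<b}))"
    using N(1) by (intro negligible_differentiable_image_negligible)
      (auto intro: negligible_Int differentiable_on_subset)
  then have neg: "negligible (insert c (insert (c + 1) (g ` (N \<inter> {a<..<b}))))" (is "negligible ?N")
    by (simp add: negligible_insert)
  \<comment> \<open>By the chain rule both velocities acquire the factor \<open>\<sigma>' s\<close>,
    which leaves the root as its modulus, exactly the Jacobian in the change of variables.\<close>
  have speed: "curve_speed v w y y' s = \<bar>\<sigma>' s\<bar> * curve_speed v w z z' (\<sigma> s)"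
    if s: "s \<in> {c..c + 1} - ?N" for s
  proof -
    have s': "s \<in> {c<..<c + 1}"
      using s by (auto simp: less_le)
    have "\<sigma> s \<notin> N"
    proof
      assume "\<sigma> s \<in> N"
      then have "g (\<sigma> s) \<in> g ` (N \<inter> {a<..<b})"
        using \<sigma>_Ioo[OF s'] by blast
      then show False
        using s by (simp add: g_\<sigma>)
    qed
    then have "(v \<circ> z has_vector_derivative ?V (\<sigma> s)) (at (\<sigma> s))"
      using \<sigma>_Icc by (intro N(2)) auto
    then have "(v \<circ> z \<circ> \<sigma> has_vector_derivative \<sigma>' s *\<^sub>R ?V (\<sigma> s)) (at s)"
      using der[unfolded has_real_derivative_iff_has_vector_derivative]
      by (intro vector_diff_chain_at)
    then have "vector_derivative (v \<circ> y) (at s) = \<sigma>' s *\<^sub>R ?V (\<sigma> s)"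
      unfolding y_def o_assoc by (rule vector_derivative_at)
    then have "curve_speed v w y y' s = sqrt ((\<sigma>' s)\<^sup>2 * ((norm (z' (\<sigma> s)))\<^sup>2
        - (norm (?V (\<sigma> s)))\<^sup>2 + (w \<bullet> ?V (\<sigma> s))\<^sup>2))"
      by (simp add: curve_speed_def y'_def power_mult_distrib algebra_simps)
    then show ?thesis
      by (simp add: curve_speed_def real_sqrt_mult)
  qed
  have "curve_speed v w z z' absolutely_integrable_on {a<..<b}"
    using curve_speed_absolutely_integrable[OF v z] by (rule set_integrable_subset) auto
  then have "integral {c<..<c + 1} (\<lambda>s. \<bar>\<sigma>' s\<bar> * curve_speed v w z z' (\<sigma> s))
      = integral {a<..<b} (curve_speed v w z z')"
    using has_absolute_integral_change_of_variables_1'[OF _ der inj,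
        of "curve_speed v w z z'" "integral {a<..<b} (curve_speed v w z z')"]
    by (simp add: image)
  then have "integral {c..c + 1} (\<lambda>s. \<bar>\<sigma>' s\<bar> * curve_speed v w z z' (\<sigma> s))
      = integral {a..b} (curve_speed v w z z')"
    by (simp only: integral_open_interval_real)
  moreover have "integral {c..c + 1} (curve_speed v w y y')
      = integral {c..c + 1} (\<lambda>s. \<bar>\<sigma>' s\<bar> * curve_speed v w z z' (\<sigma> s))"
    using speed by (intro integral_spike[OF neg]) auto
  ultimately show thesis
    using path ends by (intro that[of y y']) (auto simp: y_def y'_def)
qed

text \<open>The two curves are reparametrised over \<open>{0..1}\<close> and \<open>{1..2}\<close>.
  At the joint 1 both velocities are 0, so the concatenation is again a
  \<open>C1_path\<close>.\<close>

lemma curve_lengths_add: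
  fixes v :: "real^'n \<Rightarrow> real^'m"
  assumes v: "1-lipschitz_on UNIV v"
    and "l1 \<in> curve_lengths v w x y" "l2 \<in> curve_lengths v w y q"
  shows "l1 + l2 \<in> curve_lengths v w x q"
proof -
  obtain a b z z' where z: "C1_path a b z z'" "z a = x" "z b = y"
      "l1 = integral {a..b} (curve_speed v w z z')"
    using assms(2) by (auto simp: curve_lengths_def)
  obtain z1 z1' where z1: "C1_path 0 (0 + 1) z1 z1'" "z1 0 = x" "z1 (0 + 1) = y" "z1' (0 + 1) = 0"
      "integral {0..0 + 1} (curve_speed v w z1 z1') = l1"
    using C1_path_reparametrize[OF v z(1), where c = 0 and w = w] unfolding z(2-4) by metis
  obtain a b z z' where z: "C1_path a b z z'" "z a = y" "z b = q"
      "l2 = integral {a..b} (curve_speed v w z z')"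
    using assms(3) by (auto simp: curve_lengths_def)
  obtain z2 z2' where z2: "C1_path 1 (1 + 1) z2 z2'" "z2 1 = y" "z2 (1 + 1) = q" "z2' 1 = 0"
      "integral {1..1 + 1} (curve_speed v w z2 z2') = l2"
    using C1_path_reparametrize[OF v z(1), where c = 1 and w = w] unfolding z(2-4) by metis
  note z1 = z1[simplified] and z2 = z2[simplified]
  define y where "y t = (if t \<in> {0..1} then z1 t else z2 t)" for t :: real
  define y' where "y' t = (if t \<in> {0..1} then z1' t else z2' t)" for t :: real
  have un: "{0..2} = {0..1} \<union> {1..2::real}"
    by auto
  have clos: "closure {0..1::real} \<inter> closure {1..2} = {1}"
    by auto
  have path: "C1_path 0 2 y y'"
    unfolding C1_path_def
  proof (intro conjI ballI)
    fix t :: real assume t: "t \<in> {0..2}"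
    show "(y has_vector_derivative y' t) (at t within {0..2})"
      unfolding y_def y'_def
    proof (rule has_vector_derivative_If_within_closures[where T = "{1..2}"], unfold clos)
      show "(z1 has_vector_derivative z1' t) (at t within {0..1} \<union> {1})" if "t \<in> {0..1} \<union> {1}"
        using z1(1) that by (auto simp: C1_path_def insert_absorb)
      show "(z2 has_vector_derivative z2' t) (at t within {1..2} \<union> {1})" if "t \<in> {1..2} \<union> {1}"
        using z2(1) that by (auto simp: C1_path_def insert_absorb)
    qed (use t un z1 z2 in auto)
  next
    have "continuous_on {0..2} (\<lambda>t. if t \<le> 1 then z1' t else z2' t)"
      using z1 z2 by (intro continuous_on_cases_le continuous_on_id)
        (auto simp: C1_path_def elim!: continuous_on_subset)
    then show "continuous_on {0..2} y'"
      by (rule continuous_on_eq) (auto simp: y'_def)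
  qed simp
  \<comment> \<open>The speed involves the curve in a neighbourhood of \<open>t\<close>, so
    agreement on an open set is needed; the points 0, 1 and 2 are left out of the comparison as a
    null set.\<close>
  have speed: "curve_speed v w y y' t = curve_speed v w p p' t"
    if "t \<in> S" "open S" "\<And>s. s \<in> S \<Longrightarrow> y s = p s \<and> y' s = p' s" for t S p p'
  proof -
    have "\<forall>\<^sub>F s in nhds t. s \<in> S"
      using that by (intro eventually_nhds_in_open)
    then have "vector_derivative (v \<circ> y) (at t) = vector_derivative (v \<circ> p) (at t)"
      by (intro vector_derivative_cong_eq) (auto elim!: eventually_mono simp: that)
    then show ?thesis
      using that by (simp add: curve_speed_def)
  qed
  have "integral {0..1} (curve_speed v w y y') = integral {0..1} (curve_speed v w z1 z1')"
    by (intro integral_spike[of "{0, 1}"] speed[of _ "{0<..<1}", symmetric]) (auto simp: y_def y'_def)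
  moreover have "integral {1..2} (curve_speed v w y y') = integral {1..2} (curve_speed v w z2 z2')"
    by (intro integral_spike[of "{1, 2}"] speed[of _ "{1<..<2}", symmetric]) (auto simp: y_def y'_def)
  moreover have "integral {0..1} (curve_speed v w y y') + integral {1..2} (curve_speed v w y y')
      = integral {0..2} (curve_speed v w y y')"
    using curve_speed_has_integral[OF v path]
    by (intro Henstock_Kurzweil_Integration.integral_combine) auto
  ultimately have "l1 + l2 = integral {0..2} (curve_speed v w y y')"
    using z1(5) z2(5) by simp
  moreover have "y 0 = x" "y 2 = q"
    using z1 z2 by (auto simp: y_def)
  ultimately show ?thesis
    using path unfolding curve_lengths_def by blast
qed

text \<open>The infimum is taken over one length at a time, first over \<open>l2\<close> with
  \<open>l1\<close> fixed and then over \<open>l1\<close>.\<close>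

lemma curve_dist_triangle:
  fixes v :: "real^'n \<Rightarrow> real^'m"
  assumes w: "norm w = 1" and v: "1-lipschitz_on UNIV v"
  shows "curve_dist v w x q \<le> curve_dist v w x y + curve_dist v w y q"
proof -
  have le: "curve_dist v w x q \<le> l1 + l2"
    if "l1 \<in> curve_lengths v w x y" "l2 \<in> curve_lengths v w y q" for l1 l2
    using curve_dist_le[OF w v curve_lengths_add[OF v that]] .
  have "curve_dist v w x q - l1 \<le> curve_dist v w y q" if "l1 \<in> curve_lengths v w x y" for l1
    unfolding curve_dist_eq_Inf[of v w y q]
  proof (rule cInf_greatest[OF curve_lengths_nonempty[OF w v]])
    show "curve_dist v w x q - l1 \<le> l2" if "l2 \<in> curve_lengths v w y q" for l2
      using le[OF \<open>l1 \<in> _\<close> that] by simp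
  qed
  then have "curve_dist v w x q - curve_dist v w y q \<le> curve_dist v w x y"
    unfolding curve_dist_eq_Inf[of v w x y]
    by (intro cInf_greatest[OF curve_lengths_nonempty[OF w v]]) (simp add: algebra_simps)
  then show ?thesis
    by simp
qed

subsection \<open>Extension\<close>

text \<open>The largest increment that the \<open>w\<close>-component of a 1-Lipschitz map may have from \<open>y\<close> to \<open>x\<close>
  when its other components are those of \<open>v\<close>.\<close>

definition slack :: "(real^'n \<Rightarrow> real^'m) \<Rightarrow> real^'m \<Rightarrow> real^'n \<Rightarrow> real^'n \<Rightarrow> real" where
  "slack v w x y = sqrt ((norm (x - y))\<^sup>2 - (norm (v x - v y - (w \<bullet> (v x - v y)) *\<^sub>R w))\<^sup>2)"

lemma slack_commute: "slack v w x y = slack v w y x"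
proof -
  have "v y - v x - (w \<bullet> (v y - v x)) *\<^sub>R w = - (v x - v y - (w \<bullet> (v x - v y)) *\<^sub>R w)"
    by (simp add: inner_diff_right algebra_simps)
  then show ?thesis
    unfolding slack_def by (metis norm_minus_cancel norm_minus_commute)
qed

lemma curve_dist_le_slack:
  assumes "norm w = 1" "1-lipschitz_on UNIV v"
  shows "curve_dist v w x y \<le> slack v w x y"
proof -
  have "curve_dist v w x y \<le> slack v w y x"
    unfolding slack_def using curve_dist_upper[OF assms, of x y] by (intro real_le_rsqrt) simp
  then show ?thesis
    by (subst slack_commute)
qed

text \<open>As \<open>v\<close> is itself 1-Lipschitz, its own \<open>w\<close>-component is an
  admissible choice. This serves for empty \<open>A\<close> and for the barriers of the
  truncation.\<close>

lemma inner_diff_le_slack: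
  assumes w: "norm w = 1" and v: "1-lipschitz_on UNIV v"
  shows "w \<bullet> v x - w \<bullet> v y \<le> slack v w x y"
  unfolding slack_def
proof (rule real_le_rsqrt)
  have "(norm (v x - v y))\<^sup>2 \<le> (norm (x - y))\<^sup>2"
    using lipschitz_on_normD[OF v, of x y] by (intro power_mono) auto
  then show "(w \<bullet> v x - w \<bullet> v y)\<^sup>2
      \<le> (norm (x - y))\<^sup>2 - (norm (v x - v y - (w \<bullet> (v x - v y)) *\<^sub>R w))\<^sup>2"
    unfolding pythagoras_unit[OF w] by (simp add: inner_diff_right)
qed

text \<open>For a unit vector \<open>w\<close> this is the projection of \<open>v x\<close> plus
  \<open>f x *\<^sub>R w\<close>. Written as a correction of \<open>v\<close>, it shows the distance
  to \<open>v\<close> directly as the modulus of \<open>f x - w \<bullet> v x\<close>.\<close>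

definition replace_component :: "real^'m \<Rightarrow> (real^'n \<Rightarrow> real^'m) \<Rightarrow> (real^'n \<Rightarrow> real) \<Rightarrow> real^'n \<Rightarrow> real^'m" where
  "replace_component w v f x = v x + (f x - w \<bullet> v x) *\<^sub>R w"

text \<open>By Pythagoras the squared increment is the square of the projected increment of
  \<open>v\<close> plus that of the increment of \<open>f\<close>, and \<open>slack\<close> is what
  the second may use up.\<close>

lemma replace_component_lipschitz:
  assumes w: "norm w = 1" and v: "1-lipschitz_on UNIV v"
    and f: "\<And>x y. f x - f y \<le> slack v w x y"
  shows "1-lipschitz_on UNIV (replace_component w v f)"
proof (rule lipschitz_onI)
  fix x y
  let ?u = "replace_component w v f"
  have ww: "w \<bullet> w = 1"
    using w by (simp add: dot_square_norm)
  \<comment> \<open>Nonnegativity of the radicand lets the square of \<open>slack\<close> be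
    computed; it is read off from the segment bound.\<close>
  have "0 \<le> (norm (x - y))\<^sup>2 - (norm (v x - v y - (w \<bullet> (v x - v y)) *\<^sub>R w))\<^sup>2"
    using curve_dist_upper[OF w v, of y x] zero_le_power2[of "curve_dist v w y x"] by linarith
  then have sq: "(slack v w x y)\<^sup>2 = (norm (x - y))\<^sup>2 - (norm (v x - v y - (w \<bullet> (v x - v y)) *\<^sub>R w))\<^sup>2"
    by (simp add: slack_def)
  have "\<bar>f x - f y\<bar> \<le> slack v w x y"
    using f[of x y] f[of y x] by (simp add: slack_commute[of v w y x])
  then have "(f x - f y)\<^sup>2 \<le> (slack v w x y)\<^sup>2"
    by (metis abs_ge_zero power2_abs power_mono)
  moreover have "w \<bullet> (?u x - ?u y) = f x - f y"
    by (simp add: replace_component_def inner_diff_right inner_add_right ww)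
  moreover have "?u x - ?u y - (f x - f y) *\<^sub>R w = v x - v y - (w \<bullet> (v x - v y)) *\<^sub>R w"
    by (simp add: replace_component_def inner_diff_right algebra_simps)
  ultimately have "(norm (?u x - ?u y))\<^sup>2 \<le> (norm (x - y))\<^sup>2"
    using pythagoras_unit[OF w, of "?u x - ?u y"] sq by simp
  then show "dist (?u x) (?u y) \<le> 1 * dist x y"
    by (simp add: dist_norm)
qed simp

lemma replace_component_span: "v x - replace_component w v f x \<in> span {w}"
  by (simp add: replace_component_def span_base span_neg span_scale)

lemma replace_component_eq:
  assumes w: "norm w = 1" and "v x - u \<in> span {w}" "f x = w \<bullet> u"
  shows "replace_component w v f x = u"
proof -
  obtain c where "v x - u = c *\<^sub>R w"
    using assms(2) by (auto simp: span_singleton)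
  then have "v x = u + c *\<^sub>R w"
    by (simp add: algebra_simps)
  moreover have "w \<bullet> w = 1"
    using w by (simp add: dot_square_norm)
  ultimately show ?thesis
    using assms(3) by (simp add: replace_component_def inner_add_right)
qed

text \<open>Each \<open>a\<close> in \<open>A\<close> allows at \<open>x\<close> at most the value
  \<open>f a + d a x\<close>; the infimum of these is the largest candidate. Here \<open>d\<close>
  is read as an oriented distance from its first argument to its second.\<close>

lemma McShane_extension:
  fixes f :: "'a \<Rightarrow> real"
  assumes ne: "A \<noteq> {}"
    and refl: "\<And>x. d x x \<le> 0" and tri: "\<And>x y z. d x z \<le> d x y + d y z"
    and f: "\<And>x y. x \<in> A \<Longrightarrow> y \<in> A \<Longrightarrow> f y - f x \<le> d x y"
  obtains g where "\<And>x. x \<in> A \<Longrightarrow> g x = f x" "\<And>x y. g y - g x \<le> d x y"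
proof -
  define g where "g x = (INF a\<in>A. f a + d a x)" for x
  obtain a0 where a0: "a0 \<in> A"
    using ne by blast
  \<comment> \<open>One fixed point \<open>a0\<close> anchors the lower bound:
    \<open>f a0 - f a \<le> d a a0 \<le> d a x + d x a0\<close>.\<close>
  have bdd: "bdd_below ((\<lambda>a. f a + d a x) ` A)" for x
  proof (rule bdd_belowI2)
    show "f a0 - d x a0 \<le> f a + d a x" if "a \<in> A" for a
      using f[OF that a0] tri[of a a0 x] by linarith
  qed
  show thesis
  proof
    fix x assume x: "x \<in> A"
    have "g x \<le> f x + d x x"
      unfolding g_def using bdd x by (rule cINF_lower)
    moreover have "f x \<le> g x"
      unfolding g_def using f[OF _ x] by (intro cINF_greatest[OF ne]) (simp add: algebra_simps)
    ultimately show "g x = f x"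
      using refl[of x] by linarith
  next
    fix x y
    have "g y - d x y \<le> f a + d a x" if "a \<in> A" for a
    proof -
      have "g y \<le> f a + d a y"
        unfolding g_def using bdd that by (rule cINF_lower)
      then show ?thesis
        using tri[of a y x] by linarith
    qed
    then have "g y - d x y \<le> g x"
      unfolding g_def[of x] by (rule cINF_greatest[OF ne])
    then show "g y - g x \<le> d x y"
      by linarith
  qed
qed

theorem proposition3p3:
  fixes A :: "(real^'n) set" and w :: "real^'m"
    and v u :: "real^'n \<Rightarrow> real^'m"
  assumes "norm w = 1"
    and "1-lipschitz_on UNIV v"
    and "1-lipschitz_on A u"
    and "\<forall>x\<in>A. v x - u x \<in> span {w}"
  shows "((\<exists>u'. 1-lipschitz_on UNIV u' \<and> (\<forall>x\<in>A. u' x = u x) \<and> (\<forall>x. v x - u' x \<in> span {w}))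
            \<longleftrightarrow> (\<forall>x\<in>A. \<forall>y\<in>A. \<bar>(u x - u y) \<bullet> w\<bar> \<le> curve_dist v w x y))
       \<and> (\<forall>\<delta>\<ge>0. (\<forall>x\<in>A. norm (u x - v x) \<le> \<delta>)
            \<and> (\<forall>x\<in>A. \<forall>y\<in>A. \<bar>(u x - u y) \<bullet> w\<bar> \<le> curve_dist v w x y)
            \<longrightarrow> (\<exists>u'. 1-lipschitz_on UNIV u' \<and> (\<forall>x\<in>A. u' x = u x)
                   \<and> (\<forall>x. norm (v x - u' x) \<le> \<delta>)))"
proof -
  note w = assms(1) and v = assms(2)
  \<comment> \<open>Shared by sufficiency and the last claim, which differ only in whether
    \<open>f\<close> is truncated before it replaces the \<open>w\<close>-component.\<close>
  have ext: "\<exists>f. (\<forall>x\<in>A. f x = w \<bullet> u x) \<and> (\<forall>x y. f x - f y \<le> slack v w x y)"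
    if *: "\<forall>x\<in>A. \<forall>y\<in>A. \<bar>(u x - u y) \<bullet> w\<bar> \<le> curve_dist v w x y"
  proof (cases "A = {}")
    case True
    then show ?thesis
      using inner_diff_le_slack[OF w v] by (intro exI[of _ "\<lambda>x. w \<bullet> v x"]) simp
  next
    case False
    have "w \<bullet> u y - w \<bullet> u x \<le> curve_dist v w x y" if "x \<in> A" "y \<in> A" for x y
      using *[rule_format, OF that] by (simp add: inner_diff_right inner_commute)
    then obtain f where f: "\<And>x. x \<in> A \<Longrightarrow> f x = w \<bullet> u x" "\<And>x y. f y - f x \<le> curve_dist v w x y"
      using McShane_extension[OF False, of "curve_dist v w" "\<lambda>x. w \<bullet> u x"]
        curve_dist_self[OF w v] curve_dist_triangle[OF w v] by (metis order_refl)
    have "f x - f y \<le> slack v w x y" for x y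
      using f(2)[of x y] curve_dist_le_slack[OF w v, of y x] by (simp add: slack_commute[of v w x y])
    with f(1) show ?thesis
      by blast
  qed
  show ?thesis
  proof (intro conjI iffI allI impI)
    assume "\<exists>u'. 1-lipschitz_on UNIV u' \<and> (\<forall>x\<in>A. u' x = u x) \<and> (\<forall>x. v x - u' x \<in> span {w})"
    then obtain u' where u': "1-lipschitz_on UNIV u'" "\<forall>x\<in>A. u' x = u x" "\<And>x. v x - u' x \<in> span {w}"
      by blast
    show "\<forall>x\<in>A. \<forall>y\<in>A. \<bar>(u x - u y) \<bullet> w\<bar> \<le> curve_dist v w x y"
      using curve_dist_lower[OF w v u'(1,3)] u'(2) by metis
  next
    assume "\<forall>x\<in>A. \<forall>y\<in>A. \<bar>(u x - u y) \<bullet> w\<bar> \<le> curve_dist v w x y"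
    from ext[OF this] obtain f where f: "\<And>x. x \<in> A \<Longrightarrow> f x = w \<bullet> u x"
        "\<And>x y. f x - f y \<le> slack v w x y"
      by blast
    have "replace_component w v f x = u x" if "x \<in> A" for x
      using assms(4) that f(1) by (intro replace_component_eq[OF w]) auto
    then show "\<exists>u'. 1-lipschitz_on UNIV u' \<and> (\<forall>x\<in>A. u' x = u x) \<and> (\<forall>x. v x - u' x \<in> span {w})"
      using replace_component_lipschitz[OF w v f(2)] replace_component_span by blast
  next
    fix \<delta> :: real
    assume "0 \<le> \<delta>" and "(\<forall>x\<in>A. norm (u x - v x) \<le> \<delta>)
      \<and> (\<forall>x\<in>A. \<forall>y\<in>A. \<bar>(u x - u y) \<bullet> w\<bar> \<le> curve_dist v w x y)"
    then have \<delta>: "\<And>x. x \<in> A \<Longrightarrow> norm (u x - v x) \<le> \<delta>"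
      and *: "\<forall>x\<in>A. \<forall>y\<in>A. \<bar>(u x - u y) \<bullet> w\<bar> \<le> curve_dist v w x y"
      by blast+
    from ext[OF *] obtain f where f: "\<And>x. x \<in> A \<Longrightarrow> f x = w \<bullet> u x"
        "\<And>x y. f x - f y \<le> slack v w x y"
      by blast
    \<comment> \<open>The barriers are the values for which the corrected map stays within
      \<open>\<delta>\<close> of \<open>v\<close>. Their increments, like those of \<open>f\<close>,
      are bounded by \<open>slack\<close>, and \<open>max\<close> and \<open>min\<close> preserve
      such a bound.\<close>
    define g where "g x = max (w \<bullet> v x - \<delta>) (min (f x) (w \<bullet> v x + \<delta>))" for x
    have "g x - g y \<le> slack v w x y" for x y
      using f(2)[of x y] inner_diff_le_slack[OF w v, of x y] by (auto simp: g_def max_def min_def)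
    then have "1-lipschitz_on UNIV (replace_component w v g)"
      by (rule replace_component_lipschitz[OF w v])
    moreover have "replace_component w v g x = u x" if x: "x \<in> A" for x
    proof (rule replace_component_eq[OF w])
      \<comment> \<open>On \<open>A\<close> the value \<open>w \<bullet> u x\<close> already lies
        between the barriers, so the truncation does not change \<open>f\<close> there.\<close>
      have "\<bar>w \<bullet> (u x - v x)\<bar> \<le> \<delta>"
        using Cauchy_Schwarz_ineq2[of w "u x - v x"] \<delta>[OF x] w by simp
      then show "g x = w \<bullet> u x"
        using f(1)[OF x] by (simp add: g_def inner_diff_right max_def min_def abs_le_iff)
    qed (use assms(4) x in auto)
    moreover have "norm (v x - replace_component w v g x) \<le> \<delta>" for x
    proof -
      have "\<bar>g x - w \<bullet> v x\<bar> \<le> \<delta>"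
        using \<open>0 \<le> \<delta>\<close> by (auto simp: g_def max_def min_def)
      then show ?thesis
        using w by (simp add: replace_component_def)
    qed
    ultimately show "\<exists>u'. 1-lipschitz_on UNIV u' \<and> (\<forall>x\<in>A. u' x = u x) \<and> (\<forall>x. norm (v x - u' x) \<le> \<delta>)"
      by blast
  qed
qed

end
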